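(* Let $L(q,\dot q,\Theta,t)=\mathcal{T}-\mathcal{U}$ be the Lagrangian of the manipulator, where $\mathcal{T}=\sum_{l=1}^N\mathcal{T}_l$ and $\mathcal{U}=\sum_{l=1}^N\mathcal{U}_l$ are the total kinetic and potential energies of an open kinematic chain of $N$ bodies with time-dependent mass densities, internal movement of mass-carrying particles, and constant kinematic parameters (all as defined in the context). Then the dynamics given by the Lagrange formalism $$\frac{\mathrm{d}}{\mathrm{d}t}\Big(\frac{\partial L(q,\dot q,\Theta,t)}{\partial\dot q_k}\Big)-\frac{\partial L(q,\dot q,\Theta,t)}{\partial q_k}=\tau_k+w_k,\qquad k\in\{1,\ldots,n\},$$ with joint torques/forces $\tau(t)\in\mathbb{R}^n$ and disturbance $w(t)\in\mathbb{R}^n$, rewrite as the generalized robotics equation $$M(q,\Theta)\ddot q+\big(C(q,\dot q,\Theta)+M(q,\dot\Theta)+H(q,\Psi)\big)\dot q+G(q,\Theta)=\tau+w-J(q)^\top\mathcal{Q}(q)^\top\dot\Psi,$$ where $$M(q,\Theta)=J(q)^\top\mathcal{Q}(q)^\top\mathcal{Z}(\Theta)\mathcal{Q}(q)J(q)=\big(M_{k,j}(q,\Theta)\big)_{(k,j)\in\{1,\ldots,n\}^2},$$ $$C(q,\dot q,\Theta)=\Big(\sum_{i=1}^n\Gamma_{i,j,k}(q,\Theta)\dot q_i\Big)_{(k,j)\in\{1,\ldots,n\}^2},\quad\Gamma_{i,j,k}=\frac12\Big(\frac{\partial M_{k,j}}{\partial q_i}+\frac{\partial M_{k,i}}{\partial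 q_j}-\frac{\partial M_{i,j}}{\partial q_k}\Big),$$ $$G(q,\Theta)=\Big(\frac{\partial\mathcal{U}(q,\Theta)}{\partial q}\Big)^\top,\qquad H(q,\Psi)=\frac{\partial\big(J(q)^\top\mathcal{Q}(q)^\top\Psi\big)}{\partial q}-\Big(\frac{\partial\big(J(q)^\top\mathcal{Q}(q)^\top\Psi\big)}{\partial q}\Big)^\top,$$ and $\Psi$ is held fixed in the differentiations with respect to $q$ defining $H$.
   Context: Notation: $\mathrm{I}_p$ is the $p\times p$ identity, $\mathrm{sym}(p)$ the real symmetric $p\times p$ matrices. For $x\in\mathbb{R}^3$, $\mathcal{S}(x)$ is the skew-symmetric $3\times3$ matrix with $\mathcal{S}(x)y=x\times y$ for all $y\in\mathbb{R}^3$. All functions are smooth enough, and all integrals finite, for the expressions written to make sense. Model. The pose of the $l$th body-fixed frame relative to a Newtonian frame is given by the position $z_l\in\mathbb{R}^3$ of its origin and rotation angles $\phi_l\in\mathbb{R}^3$ parameterizing the rotation matrix $\mathcal{R}(\phi_l)\in\mathrm{SO}(3)$. Put $v_l=\dot z_l$, and let $\omega_l\in\mathbb{R}^3$ be the angular velocity with $\mathcal{S}(\omega_l)=\mathcal{R}(\phi_l)^\top\dot{\mathcal{R}}(\phi_l)$; $E(\phi_l)\in\mathbb{R}^{3\times3}$ is the matrix with $\omega_l=E(\phi_l)\dot\phi_l$. For body $l$, $\rho_l(x,t)\in\mathbb{R}$ is the density of mass-carrying particles at the position $x$ in the body-fixed frame, $\varsigma_l(x,t)\in[0,1]$ the portion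 of these particles moving with velocity $\mathscr{v}_l(x,t)\in\mathbb{R}^3$ relative to the body-fixed frame; the remaining portion $1-\varsigma_l$ is immobile in it. The quantities $\varsigma_l,\mathscr{v}_l,\dot\rho_l$ are independent of $z_l,\phi_l$ and their time derivatives (external processes). The inertial parameters are $$m_l(t)=\int\rho_l(x,t)\,\mathrm{d}x,\quad h_l(t)=\int\rho_l(x,t)x\,\mathrm{d}x\in\mathbb{R}^3,\quad I_l(t)=\int\rho_l(x,t)\mathcal{S}(x)^\top\mathcal{S}(x)\,\mathrm{d}x\in\mathrm{sym}(3)$$ (integrals over $\mathbb{R}^3$), collected in $\Phi_l=(m_l,h_{1,l},h_{2,l},h_{3,l},I_{11,l},I_{22,l},I_{33,l},I_{12,l},I_{23,l},I_{13,l})^\top\in\mathbb{R}^{10}$ and $\Theta(t)=(\Phi_1^\top,\ldots,\Phi_N^\top)^\top\in\mathbb{R}^{10N}$. Kinematics. With generalized coordinates $q(t)\in\mathbb{R}^n$ and constant kinematic parameters (standing assumption), $(z_1^\top,\phi_1^\top,\ldots,z_N^\top,\phi_N^\top)^\top=F(q)=(F_{z_1}(q)^\top,F_{\phi_1}(q)^\top,\ldots,F_{z_N}(q)^\top,F_{\phi_N}(q)^\top)^\top$, and $J(q)=\partial F(q)/\partial q\in\mathbb{R}^{6N\times n}$, so that $(v_1^\top,\dot\phi_1^\top,\ldots,v_N^\top,\dot\phi_N^\top)^\top=J(q)\dot q$. Energies. Kinetic energy of body $l$: $$\mathcal{T}_l=\frac12\int_{\mathbb{R}^3}\Big((1-\varsigma_l)\rho_l\big\|\mathcal{R}(\phi_l)^\top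 v_l+\omega_l\times x\big\|^2+\varsigma_l\rho_l\big\|\mathscr{v}_l+\mathcal{R}(\phi_l)^\top v_l+\omega_l\times x\big\|^2\Big)\mathrm{d}x,$$ with $\varsigma_l,\rho_l,\mathscr{v}_l$ evaluated at $(x,t)$. Potential energy of body $l$ in a constant gravitational field $g\in\mathbb{R}^3$: $\mathcal{U}_l=g^\top(m_lz_l+\mathcal{R}(\phi_l)h_l)$. Both are expressed through $q,\dot q,\Theta,t$ by means of the kinematics; thus $\mathcal{U}(q,\Theta)=g^\top\sum_{l=1}^N\big(m_lF_{z_l}(q)+\mathcal{R}(F_{\phi_l}(q))h_l\big)$. Matrices. $Q(\phi)=\mathrm{diag}(\mathcal{R}(\phi)^\top,E(\phi))\in\mathbb{R}^{6\times6}$, $\mathcal{Q}(q)=\mathrm{diag}(Q(F_{\phi_1}(q)),\ldots,Q(F_{\phi_N}(q)))$, $$Z(\Phi_l)=\begin{pmatrix}m_l\mathrm{I}_3&-\mathcal{S}(h_l)\\-\mathcal{S}(h_l)^\top&I_l\end{pmatrix},\qquad\mathcal{Z}(\Theta)=\mathrm{diag}(Z(\Phi_1),\ldots,Z(\Phi_N)).$$ $M(q,\dot\Theta)$ means $M$ evaluated with $\dot\Theta$ in place of $\Theta$. The lumped particle velocity is $\Psi(t)=(\psi_1(t)^\top,\ldots,\psi_N(t)^\top)^\top\in\mathbb{R}^{6N}$ with $\psi_l(t)=\int_{\mathbb{R}^3}\varsigma_l(x,t)\rho_l(x,t)\begin{pmatrix}\mathrm{I}_3\\\mathcal{S}(x)\end{pmatrix}\mathscr{v}_l(x,t)\,\mathrm{d}x$.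 *)

theory Defs
  imports "HOL-Analysis.Analysis"
begin

unbundle cross3_syntax

(* Conventions.  Bodies are indexed by the finite type 'b (N = CARD('b)), generalized coordinates
   by 'n (n = CARD('n)).  R^6N is real ^ ('b * (3 + 3)): entry (l, Inl i) is the i-th entry of the
   upper (position / force) half of block l, entry (l, Inr i) the i-th entry of the lower (angle /
   torque) half.  Stacked inertial parameters in R^10N are real ^ 10 ^ 'b, so that Theta $ l is the
   parameter vector Phi_l; in type 10 the numeral 10 denotes the same index as 0, and the
   indices 1, ..., 10 are distinct. *)


subsection \<open>Matrices and calculus\<close>

definition skew :: "real^3 \<Rightarrow> real^3^3"
  where "skew x = matrix (\<lambda>y. x \<times> y)"

definition block_col :: "real^'c^'a::finite \<Rightarrow> real^'c^'b::finite \<Rightarrow> real^'c^('a + 'b)"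
  where "block_col A B = (\<chi> i. case i of Inl a \<Rightarrow> A $ a | Inr b \<Rightarrow> B $ b)"

definition block_mat ::
    "real^'c::finite^'a::finite \<Rightarrow> real^'d::finite^'a \<Rightarrow> real^'c^'b::finite \<Rightarrow> real^'d^'b
      \<Rightarrow> real^('c + 'd)^('a + 'b)"
  where "block_mat A B C D =
    (\<chi> i j. case i of
        Inl a \<Rightarrow> (case j of Inl c \<Rightarrow> A $ a $ c | Inr d \<Rightarrow> B $ a $ d)
      | Inr b \<Rightarrow> (case j of Inl c \<Rightarrow> C $ b $ c | Inr d \<Rightarrow> D $ b $ d))"

definition block_diag ::
    "('b::finite \<Rightarrow> real^'c::finite^'a::finite) \<Rightarrow> real^('b \<times> 'c)^('b \<times> 'a)"
  where "block_diag A = (\<chi> i j. if fst i = fst j then A (fst i) $ snd i $ snd j else 0)"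

definition upper :: "'b \<Rightarrow> real^('b::finite \<times> (3 + 3)) \<Rightarrow> real^3"
  where "upper l y = (\<chi> i. y $ (l, Inl i))"

definition lower :: "'b \<Rightarrow> real^('b::finite \<times> (3 + 3)) \<Rightarrow> real^3"
  where "lower l y = (\<chi> i. y $ (l, Inr i))"

definition partial :: "'n \<Rightarrow> (real^'n::finite \<Rightarrow> real) \<Rightarrow> real^'n \<Rightarrow> real"
  where "partial k f x = deriv (\<lambda>s. f (x + s *\<^sub>R axis k 1)) 0"

definition twice_differentiable ::
    "('a::real_normed_vector \<Rightarrow> 'c::real_normed_vector) \<Rightarrow> bool"
  where "twice_differentiable f \<longleftrightarrow>
    (\<forall>x. f differentiable (at x)) \<and>
    (\<forall>v x. (\<lambda>y. frechet_derivative f (at y) v) differentiable (at x))"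


subsection \<open>Inertial parameters\<close>

definition mass :: "(real^3 \<Rightarrow> real) \<Rightarrow> real"
  where "mass r = (LINT x|lborel. r x)"

definition first_moment :: "(real^3 \<Rightarrow> real) \<Rightarrow> real^3"
  where "first_moment r = (LINT x|lborel. r x *\<^sub>R x)"

definition inertia :: "(real^3 \<Rightarrow> real) \<Rightarrow> real^3^3"
  where "inertia r = (LINT x|lborel. r x *\<^sub>R (transpose (skew x) ** skew x))"

definition inertial_params :: "(real^3 \<Rightarrow> real) \<Rightarrow> real^10"
  where "inertial_params r =
    (let m = mass r; h = first_moment r; I = inertia r
     in vector [m, h$1, h$2, h$3, I$1$1, I$2$2, I$3$3, I$1$2, I$2$3, I$1$3])"

definition params_mass :: "real^10 \<Rightarrow> real"
  where "params_mass \<Phi> = \<Phi> $ 1"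

definition params_moment :: "real^10 \<Rightarrow> real^3"
  where "params_moment \<Phi> = vector [\<Phi> $ 2, \<Phi> $ 3, \<Phi> $ 4]"

definition params_inertia :: "real^10 \<Rightarrow> real^3^3"
  where "params_inertia \<Phi> = vector
    [vector [\<Phi> $ 5,  \<Phi> $ 8, \<Phi> $ 10],
     vector [\<Phi> $ 8,  \<Phi> $ 6, \<Phi> $ 9],
     vector [\<Phi> $ 10, \<Phi> $ 9, \<Phi> $ 7]]"

definition Theta :: "('b::finite \<Rightarrow> real^3 \<Rightarrow> real \<Rightarrow> real) \<Rightarrow> real \<Rightarrow> real^10^'b"
  where "Theta \<rho> t = (\<chi> l. inertial_params (\<lambda>x. \<rho> l x t))"


subsection \<open>Lumped particle velocity\<close>

definition particle_flux :: "real \<Rightarrow> real \<Rightarrow> real^3 \<Rightarrow> real^3 \<Rightarrow> real^(3 + 3)"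
  where "particle_flux s r p x = (s * r) *\<^sub>R (block_col (mat 1) (skew x) *v p)"

definition Psi ::
    "('b::finite \<Rightarrow> real^3 \<Rightarrow> real \<Rightarrow> real) \<Rightarrow> ('b \<Rightarrow> real^3 \<Rightarrow> real \<Rightarrow> real)
      \<Rightarrow> ('b \<Rightarrow> real^3 \<Rightarrow> real \<Rightarrow> real^3) \<Rightarrow> real \<Rightarrow> real^('b \<times> (3 + 3))"
  where "Psi \<sigma> \<rho> \<nu> t =
    (\<chi> i. (LINT x|lborel. particle_flux (\<sigma> (fst i) x t) (\<rho> (fst i) x t) (\<nu> (fst i) x t) x) $ snd i)"


subsection \<open>Angular velocity and energies\<close>

(* Along a motion of the angles, the time derivative of the rotation matrix is the directional
   derivative of Rot at the angles \<phi> in the direction \<phi>' of the angle rates. *)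
definition angular_velocity :: "(real^3 \<Rightarrow> real^3^3) \<Rightarrow> real^3 \<Rightarrow> real^3 \<Rightarrow> real^3"
  where "angular_velocity Rot \<phi> \<phi>' =
    (THE \<omega>. skew \<omega> = transpose (Rot \<phi>) ** frechet_derivative Rot (at \<phi>) \<phi>')"

definition rate_matrix :: "(real^3 \<Rightarrow> real^3^3) \<Rightarrow> real^3 \<Rightarrow> real^3^3"
  where "rate_matrix Rot \<phi> = matrix (angular_velocity Rot \<phi>)"

definition kinetic_density ::
    "(real^3 \<Rightarrow> real^3^3) \<Rightarrow> real \<Rightarrow> real \<Rightarrow> real^3 \<Rightarrow> real^3 \<Rightarrow> real^3 \<Rightarrow> real^3 \<Rightarrow> real^3 \<Rightarrow> real"
  where "kinetic_density Rot s r p \<phi> v \<phi>' x =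
    (1 - s) * r * (norm (transpose (Rot \<phi>) *v v + angular_velocity Rot \<phi> \<phi>' \<times> x))\<^sup>2
    + s * r * (norm (p + transpose (Rot \<phi>) *v v + angular_velocity Rot \<phi> \<phi>' \<times> x))\<^sup>2"

definition body_kinetic_density ::
    "(real^'n \<Rightarrow> real^('b \<times> (3 + 3))) \<Rightarrow> (real^3 \<Rightarrow> real^3^3)
      \<Rightarrow> ('b::finite \<Rightarrow> real^3 \<Rightarrow> real \<Rightarrow> real) \<Rightarrow> ('b \<Rightarrow> real^3 \<Rightarrow> real \<Rightarrow> real)
      \<Rightarrow> ('b \<Rightarrow> real^3 \<Rightarrow> real \<Rightarrow> real^3) \<Rightarrow> 'b \<Rightarrow> real^'n::finite \<Rightarrow> real^'n \<Rightarrow> real \<Rightarrow> real^3 \<Rightarrow> real"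
  where "body_kinetic_density F Rot \<sigma> \<rho> \<nu> l q q' t x =
    (let y = F q; y' = jacobian F (at q) *v q'
     in kinetic_density Rot (\<sigma> l x t) (\<rho> l x t) (\<nu> l x t) (lower l y) (upper l y') (lower l y') x)"

definition kinetic_energy ::
    "(real^'n \<Rightarrow> real^('b \<times> (3 + 3))) \<Rightarrow> (real^3 \<Rightarrow> real^3^3)
      \<Rightarrow> ('b::finite \<Rightarrow> real^3 \<Rightarrow> real \<Rightarrow> real) \<Rightarrow> ('b \<Rightarrow> real^3 \<Rightarrow> real \<Rightarrow> real)
      \<Rightarrow> ('b \<Rightarrow> real^3 \<Rightarrow> real \<Rightarrow> real^3) \<Rightarrow> 'b \<Rightarrow> real^'n::finite \<Rightarrow> real^'n \<Rightarrow> real \<Rightarrow> real"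
  where "kinetic_energy F Rot \<sigma> \<rho> \<nu> l q q' t =
    1/2 * (LINT x|lborel. body_kinetic_density F Rot \<sigma> \<rho> \<nu> l q q' t x)"

definition potential_energy ::
    "(real^'n \<Rightarrow> real^('b::finite \<times> (3 + 3))) \<Rightarrow> (real^3 \<Rightarrow> real^3^3) \<Rightarrow> real^3
      \<Rightarrow> 'b \<Rightarrow> real^'n \<Rightarrow> real^10^'b \<Rightarrow> real"
  where "potential_energy F Rot g l q \<Theta> =
    g \<bullet> (params_mass (\<Theta> $ l) *\<^sub>R upper l (F q) + Rot (lower l (F q)) *v params_moment (\<Theta> $ l))"

definition total_potential ::
    "(real^'n \<Rightarrow> real^('b::finite \<times> (3 + 3))) \<Rightarrow> (real^3 \<Rightarrow> real^3^3) \<Rightarrow> real^3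
      \<Rightarrow> real^'n \<Rightarrow> real^10^'b \<Rightarrow> real"
  where "total_potential F Rot g q \<Theta> = (\<Sum>l\<in>UNIV. potential_energy F Rot g l q \<Theta>)"

(* The dependence of the Lagrangian on Theta is its dependence on the densities at time t;
   partial derivatives with respect to q and q' are taken at fixed t, hence at fixed Theta t. *)
definition lagrangian ::
    "(real^'n \<Rightarrow> real^('b \<times> (3 + 3))) \<Rightarrow> (real^3 \<Rightarrow> real^3^3)
      \<Rightarrow> ('b::finite \<Rightarrow> real^3 \<Rightarrow> real \<Rightarrow> real) \<Rightarrow> ('b \<Rightarrow> real^3 \<Rightarrow> real \<Rightarrow> real)
      \<Rightarrow> ('b \<Rightarrow> real^3 \<Rightarrow> real \<Rightarrow> real^3) \<Rightarrow> real^3 \<Rightarrow> real^'n::finite \<Rightarrow> real^'n \<Rightarrow> real \<Rightarrow> real"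
  where "lagrangian F Rot \<sigma> \<rho> \<nu> g q q' t =
    (\<Sum>l\<in>UNIV. kinetic_energy F Rot \<sigma> \<rho> \<nu> l q q' t) - total_potential F Rot g q (Theta \<rho> t)"

(* The total time derivative is required to exist. *)
definition lagrange_equation ::
    "(real^'n \<Rightarrow> real^'n \<Rightarrow> real \<Rightarrow> real) \<Rightarrow> (real \<Rightarrow> real^'n) \<Rightarrow> (real \<Rightarrow> real^'n)
      \<Rightarrow> real \<Rightarrow> 'n::finite \<Rightarrow> real \<Rightarrow> bool"
  where "lagrange_equation L q q' t k f \<longleftrightarrow>
    (\<exists>p. ((\<lambda>s. partial k (\<lambda>u. L (q s) u s) (q' s)) has_real_derivative p) (at t) \<and>
         p - partial k (\<lambda>y. L y (q' t) t) (q t) = f)"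


subsection \<open>Matrices of the generalized robotics equation\<close>

definition pose_matrix :: "(real^3 \<Rightarrow> real^3^3) \<Rightarrow> real^3 \<Rightarrow> real^(3 + 3)^(3 + 3)"
  where "pose_matrix Rot \<phi> = block_mat (transpose (Rot \<phi>)) 0 0 (rate_matrix Rot \<phi>)"

definition pose_matrices ::
    "(real^'n \<Rightarrow> real^('b::finite \<times> (3 + 3))) \<Rightarrow> (real^3 \<Rightarrow> real^3^3)
      \<Rightarrow> real^'n \<Rightarrow> real^('b \<times> (3 + 3))^('b \<times> (3 + 3))"
  where "pose_matrices F Rot q = block_diag (\<lambda>l. pose_matrix Rot (lower l (F q)))"

definition inertia_matrix :: "real^10 \<Rightarrow> real^(3 + 3)^(3 + 3)"
  where "inertia_matrix \<Phi> =
    block_mat (params_mass \<Phi> *\<^sub>R mat 1) (- skew (params_moment \<Phi>))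
              (- transpose (skew (params_moment \<Phi>))) (params_inertia \<Phi>)"

definition inertia_matrices :: "real^10^'b \<Rightarrow> real^('b::finite \<times> (3 + 3))^('b \<times> (3 + 3))"
  where "inertia_matrices \<Theta> = block_diag (\<lambda>l. inertia_matrix (\<Theta> $ l))"

definition M_mat ::
    "(real^'n::finite \<Rightarrow> real^('b::finite \<times> (3 + 3))) \<Rightarrow> (real^3 \<Rightarrow> real^3^3)
      \<Rightarrow> real^'n \<Rightarrow> real^10^'b \<Rightarrow> real^'n^'n"
  where "M_mat F Rot q \<Theta> =
    transpose (jacobian F (at q)) ** transpose (pose_matrices F Rot q) ** inertia_matrices \<Theta>
      ** pose_matrices F Rot q ** jacobian F (at q)"

definition christoffel ::
    "(real^'n::finite \<Rightarrow> real^('b::finite \<times> (3 + 3))) \<Rightarrow> (real^3 \<Rightarrow> real^3^3)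
      \<Rightarrow> 'n \<Rightarrow> 'n \<Rightarrow> 'n \<Rightarrow> real^'n \<Rightarrow> real^10^'b \<Rightarrow> real"
  where "christoffel F Rot i j k q \<Theta> =
    1/2 * (partial i (\<lambda>y. M_mat F Rot y \<Theta> $ k $ j) q
         + partial j (\<lambda>y. M_mat F Rot y \<Theta> $ k $ i) q
         - partial k (\<lambda>y. M_mat F Rot y \<Theta> $ i $ j) q)"

definition C_mat ::
    "(real^'n::finite \<Rightarrow> real^('b::finite \<times> (3 + 3))) \<Rightarrow> (real^3 \<Rightarrow> real^3^3)
      \<Rightarrow> real^'n \<Rightarrow> real^'n \<Rightarrow> real^10^'b \<Rightarrow> real^'n^'n"
  where "C_mat F Rot q q' \<Theta> = (\<chi> k j. \<Sum>i\<in>UNIV. christoffel F Rot i j k q \<Theta> * q' $ i)"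

definition G_vec ::
    "(real^'n::finite \<Rightarrow> real^('b::finite \<times> (3 + 3))) \<Rightarrow> (real^3 \<Rightarrow> real^3^3) \<Rightarrow> real^3
      \<Rightarrow> real^'n \<Rightarrow> real^10^'b \<Rightarrow> real^'n"
  where "G_vec F Rot g q \<Theta> = (\<chi> k. partial k (\<lambda>y. total_potential F Rot g y \<Theta>) q)"

definition H_mat ::
    "(real^'n::finite \<Rightarrow> real^('b::finite \<times> (3 + 3))) \<Rightarrow> (real^3 \<Rightarrow> real^3^3)
      \<Rightarrow> real^'n \<Rightarrow> real^('b \<times> (3 + 3)) \<Rightarrow> real^'n^'n"
  where "H_mat F Rot q \<Psi> =
    (let D = jacobian (\<lambda>y. transpose (jacobian F (at y)) *v (transpose (pose_matrices F Rot y) *v \<Psi>))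
               (at q)
     in D - transpose D)"

end

theory Submission
  imports Defs
begin

text \<open>
  With A(q) the product of the pose matrices and the Jacobian of the kinematics, expanding the squared
  norms and integrating over the density turns the kinetic energy into
  1/2 (A q')^T Z(Theta) (A q') + (A q')^T Psi + kappa(t), where kappa does not depend on (q, q').
  Its momentum is A^T (Z A q' + Psi). In the Lagrange equation the terms quadratic in q' that come from
  differentiating A regroup into the Christoffel symbols of M = A^T Z A, the derivative of Theta gives
  M(q, Theta'), the terms linear in q' with Psi give the antisymmetric matrix H, and A^T Psi' remains.
\<close>

subsection \<open>Matrix products and derivatives\<close>

lemma bounded_bilinear_matrix_matrix_mult:
  "bounded_bilinear ((**) :: real^'n^'m \<Rightarrow> real^'p^'n \<Rightarrow> real^'p^'m)"
  unfolding bilinear_conv_bounded_bilinear[symmetric] bilinear_def linear_iff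
  by (simp add: vec_eq_iff matrix_matrix_mult_def sum.distrib[symmetric] sum_distrib_left algebra_simps)

lemma bounded_bilinear_matrix_vector_mult:
  "bounded_bilinear ((*v) :: real^'n^'m \<Rightarrow> real^'n \<Rightarrow> real^'m)"
  unfolding bilinear_conv_bounded_bilinear[symmetric] bilinear_def linear_iff
  by (simp add: matrix_vector_right_distrib matrix_vector_mult_add_rdistrib
      scaleR_matrix_vector_assoc matrix_vector_mult_scaleR)

lemma bounded_bilinear_vector_matrix_mult:
  "bounded_bilinear ((v*) :: real^'m \<Rightarrow> real^'n^'m \<Rightarrow> real^'n)"
  unfolding bilinear_conv_bounded_bilinear[symmetric] bilinear_def linear_iff
  by (simp add: vector_matrix_left_distrib vector_matrix_mult_add_rdistrib scaleR_vector_matrix_assoc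
       vector_scaleR_matrix_ac)

lemma bounded_linear_transpose: "bounded_linear (transpose :: real^'n^'m \<Rightarrow> real^'m^'n)"
  unfolding linear_conv_bounded_linear[symmetric] linear_iff
  by (simp add: transpose_def vec_eq_iff)

text \<open>Row products \<open>x v* A\<close> stand for the transpose of \<open>A\<close> applied
  to \<open>x\<close>. Pairing with \<open>A *v axis k 1\<close> is the shape in which partial
  derivatives arrive from \<open>partial_eq\<close>.\<close>

lemma vector_matrix_mult_component: "((x::real^'m) v* A) $ k = (A *v axis k 1) \<bullet> x"
  by (metis dot_lmul_matrix inner_axis inner_commute inner_real_def mult.right_neutral)

lemma inner_matrix_vector_right: "(x::real^'m) \<bullet> (A *v y) = (transpose A *v x) \<bullet> y"
  by (simp add: dot_lmul_matrix)

text \<open>Chain rule along the line through \<open>x\<close> in direction \<open>axis k 1\<close>.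
  All later differentiation can thus be done with total derivatives.\<close>

lemma partial_eq:
  assumes "(f has_derivative D) (at x)"
  shows "partial k f x = D (axis k 1)"
proof -
  have "((\<lambda>s. f (x + s *\<^sub>R axis k 1)) has_derivative (\<lambda>s. D (s *\<^sub>R axis k 1))) (at 0)"
    by (rule has_derivative_compose[of "\<lambda>s. x + s *\<^sub>R axis k 1" _ 0 UNIV f D])
      (auto intro!: derivative_eq_intros assms)
  moreover have "(\<lambda>s. D (s *\<^sub>R axis k 1)) = (*) (D (axis k 1))"
    using linear_scale[OF has_derivative_linear[OF assms]] by (auto simp: mult.commute)
  ultimately show ?thesis
    unfolding partial_def by (intro DERIV_imp_deriv) (simp add: has_field_derivative_def)
qed

text \<open>The vector is the finite sum of its entries, each injected by the linear map
  \<open>axis i\<close>. Entries may themselves be vectors, so two applications handle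
  matrices.\<close>

lemma differentiable_vec_lambda:
  fixes f :: "'a::real_normed_vector \<Rightarrow> 'i::finite \<Rightarrow> 'c::euclidean_space"
  assumes "\<And>i. (\<lambda>x. f x i) differentiable F"
  shows "(\<lambda>x. \<chi> i. f x i) differentiable F"
proof -
  have lin: "bounded_linear (axis i :: 'c \<Rightarrow> 'c^'i)" for i
    unfolding linear_conv_bounded_linear[symmetric] linear_iff
    by (auto simp: axis_def vec_eq_iff)
  have "(\<lambda>x. axis i (f x i) :: 'c^'i) differentiable F" for i
    using assms[of i] bounded_linear.has_derivative[OF lin] unfolding differentiable_def by blast
  then have "(\<lambda>x. \<Sum>i\<in>UNIV. axis i (f x i) :: 'c^'i) differentiable F"
    by (intro differentiable_sum) auto
  moreover have "(\<Sum>i\<in>UNIV. axis i (f x i) :: 'c^'i) = (\<chi> i. f x i)" for x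
    by (simp add: vec_eq_iff axis_def if_distrib sum.delta cong: if_cong)
  ultimately show ?thesis by simp
qed

subsection \<open>Lagrange equation of a quadratic Lagrangian\<close>

text \<open>Abstract form of the computation, before kinematics enter: \<open>A\<close> maps
  generalized to body velocities. The term \<open>\<kappa>\<close> drops out because both partial
  derivatives are taken at fixed time, and the rest is the product rule applied to the
  momentum.\<close>

lemma lagrange_equation_quadratic:
  fixes A :: "real^'n \<Rightarrow> real^'n^'m" and Z :: "real \<Rightarrow> real^'m^'m"
  assumes "open T" "t \<in> T"
    and L: "\<And>y u s. s \<in> T \<Longrightarrow> L y u s =
      1/2 * ((A y *v u) \<bullet> (Z s *v (A y *v u))) + (A y *v u) \<bullet> \<Psi> s + \<kappa> s - U s y"
    and sym: "\<And>s. s \<in> T \<Longrightarrow> transpose (Z s) = Z s"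
    and A: "(A has_derivative A') (at (q t))"
    and U: "(U t has_derivative U') (at (q t))"
    and q: "(q has_vector_derivative q' t) (at t)"
    and q': "(q' has_vector_derivative q'' t) (at t)"
    and Z: "(Z has_vector_derivative Z') (at t)"
    and \<Psi>: "(\<Psi> has_vector_derivative \<Psi>') (at t)"
  shows "lagrange_equation L q q' t k f \<longleftrightarrow>
    ((Z t *v (A (q t) *v q' t) + \<Psi> t) v* A' (q' t)
      + (Z' *v (A (q t) *v q' t) + Z t *v (A' (q' t) *v q' t) + Z t *v (A (q t) *v q'' t) + \<Psi>')
          v* A (q t)) $ k
      - (A' (axis k 1) *v q' t) \<bullet> (Z t *v (A (q t) *v q' t) + \<Psi> t) + U' (axis k 1) = f"
    (is "_ \<longleftrightarrow> ?P $ k - _ + _ = f")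
proof -
  note mv = bounded_bilinear_matrix_vector_mult
  note mv_vd = bounded_bilinear.has_vector_derivative[OF mv]
  have sym_inner: "x \<bullet> (Z s *v y) = y \<bullet> (Z s *v x)" if "s \<in> T" for x y s
    using inner_matrix_vector_right[of x "Z s" y] sym[OF that] by (simp add: inner_commute)
  \<comment> \<open>Symmetry of \<open>Z s\<close> merges the two terms from the quadratic form and
    cancels the factor 1/2. The formula is proved for all times in \<open>T\<close> because it is
    differentiated in time next.\<close>
  have mom: "partial k (\<lambda>u. L (q s) u s) (q' s)
      = ((Z s *v (A (q s) *v q' s) + \<Psi> s) v* A (q s)) $ k" if s: "s \<in> T" for s
  proof -
    have "((\<lambda>u. L (q s) u s) has_derivative (\<lambda>h. (A (q s) *v h) \<bullet> (Z s *v (A (q s) *v q' s) + \<Psi> s)))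
      (at (q' s))"
      unfolding L[OF s]
      by (rule has_derivative_eq_rhs, (rule has_derivative_diff has_derivative_add
          has_derivative_mult_right has_derivative_inner has_derivative_const
          bounded_linear.has_derivative[OF bounded_bilinear.bounded_linear_right[OF mv]]
          has_derivative_ident)+)
        (simp add: sym_inner[OF s, of "A (q s) *v q' s"] inner_add_right fun_eq_iff)
    then show ?thesis
      by (simp add: partial_eq vector_matrix_mult_component)
  qed
  have Aq: "((\<lambda>s. A (q s)) has_vector_derivative A' (q' t)) (at t)"
    using vector_derivative_diff_chain_within[of q "q' t" t UNIV A A'] q A
    by (simp add: o_def has_derivative_at_withinI)
  have "((\<lambda>s. (Z s *v (A (q s) *v q' s) + \<Psi> s) v* A (q s)) has_vector_derivative ?P) (at t)"
    by (rule has_vector_derivative_eq_rhs,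
        rule bounded_bilinear.has_vector_derivative[OF bounded_bilinear_vector_matrix_mult],
        rule has_vector_derivative_add, rule mv_vd, rule Z, rule mv_vd, rule Aq, rule q',
        rule \<Psi>, rule Aq)
      (simp add: matrix_vector_right_distrib vector_matrix_left_distrib)
  then have "((\<lambda>s. ((Z s *v (A (q s) *v q' s) + \<Psi> s) v* A (q s)) $ k)
      has_vector_derivative ?P $ k) (at t)"
    by (rule bounded_linear.has_vector_derivative[OF bounded_linear_vec_nth])
  \<comment> \<open>Momentum and formula agree only on \<open>T\<close>; as \<open>T\<close> is an
    open neighbourhood of \<open>t\<close>, the derivative at \<open>t\<close> carries over.\<close>
  then have D: "((\<lambda>s. partial k (\<lambda>u. L (q s) u s) (q' s)) has_real_derivative ?P $ k) (at t)"
    unfolding has_real_derivative_iff_has_vector_derivative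
    by (rule has_vector_derivative_transform_within_open[OF _ \<open>open T\<close> \<open>t \<in> T\<close>]) (simp add: mom)
  have "((\<lambda>y. L y (q' t) t) has_derivative
      (\<lambda>h. (A' h *v q' t) \<bullet> (Z t *v (A (q t) *v q' t) + \<Psi> t) - U' h)) (at (q t))"
    unfolding L[OF \<open>t \<in> T\<close>]
    by (rule has_derivative_eq_rhs, (rule has_derivative_diff has_derivative_add
          has_derivative_mult_right has_derivative_inner has_derivative_const
          bounded_linear.has_derivative[OF bounded_bilinear.bounded_linear_right[OF mv]]
          bounded_linear.has_derivative[OF bounded_bilinear.bounded_linear_left[OF mv]]
          A U)+)
        (simp add: sym_inner[OF \<open>t \<in> T\<close>, of "A (q t) *v q' t"] inner_add_right fun_eq_iff)
  note partial_L = partial_eq[OF this, of k]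
  \<comment> \<open>Uniqueness of derivatives removes the existential quantifier in
    \<open>lagrange_equation\<close>.\<close>
  have "lagrange_equation L q q' t k f \<longleftrightarrow> ?P $ k - partial k (\<lambda>y. L y (q' t) t) (q t) = f"
    unfolding lagrange_equation_def using D DERIV_unique by blast
  then show ?thesis
    unfolding partial_L diff_diff_eq2 diff_add_eq .
qed

subsection \<open>Block matrices and angular velocity\<close>

lemma sum_blocks:
  fixes f :: "'b::finite \<times> (3 + 3) \<Rightarrow> 'c::comm_monoid_add"
  shows "(\<Sum>i\<in>UNIV. f i) =
    (\<Sum>l\<in>UNIV. (\<Sum>i\<in>UNIV. f (l, Inl i)) + (\<Sum>i\<in>UNIV. f (l, Inr i)))"
proof -
  have "(\<Sum>i\<in>UNIV. f i) = (\<Sum>l\<in>UNIV. \<Sum>i\<in>UNIV. f (l, i))"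
    unfolding UNIV_Times_UNIV[symmetric] by (subst sum.cartesian_product) simp
  moreover have "(\<Sum>i\<in>UNIV. h i) = (\<Sum>i\<in>UNIV. h (Inl i)) + (\<Sum>i\<in>UNIV. h (Inr i))"
    for h :: "3 + 3 \<Rightarrow> 'c"
    by (subst UNIV_Plus_UNIV[symmetric], subst sum.Plus) (auto simp: o_def)
  ultimately show ?thesis by simp
qed

lemma inner_blocks:
  "(x :: real^('b::finite \<times> (3 + 3))) \<bullet> y =
    (\<Sum>l\<in>UNIV. upper l x \<bullet> upper l y + lower l x \<bullet> lower l y)"
  by (simp add: inner_vec_def sum_blocks upper_def lower_def)

lemma block_diag_mult_blocks:
  shows upper_block_diag_mult:
      "upper l (block_diag (\<lambda>l. block_mat (A l) (B l) (C l) (D l)) *v y)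
        = A l *v upper l y + B l *v lower l y"
    and lower_block_diag_mult:
      "lower l (block_diag (\<lambda>l. block_mat (A l) (B l) (C l) (D l)) *v y)
        = C l *v upper l y + D l *v lower l y"
proof -
  \<comment> \<open>The test in \<open>block_diag\<close> compares body indices only, so it is
    constant in the sum over the entries of a block; pulled out, it leaves a delta sum over
    bodies.\<close>
  have pull_if: "(\<Sum>j\<in>UNIV. if P then f j else 0) = (if P then sum f UNIV else 0)"
    for P and f :: "3 \<Rightarrow> real"
    by simp
  show "upper l (block_diag (\<lambda>l. block_mat (A l) (B l) (C l) (D l)) *v y)
        = A l *v upper l y + B l *v lower l y"
    and "lower l (block_diag (\<lambda>l. block_mat (A l) (B l) (C l) (D l)) *v y)
        = C l *v upper l y + D l *v lower l y"
    by (simp_all add: vec_eq_iff upper_def lower_def block_diag_def block_mat_def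
      matrix_vector_mult_def sum_blocks if_distrib[of "\<lambda>x. x * _"] sum.distrib pull_if cong: if_cong)
qed

lemma transpose_block_diag: "transpose (block_diag A) = block_diag (\<lambda>l. transpose (A l))"
  by (auto simp: vec_eq_iff transpose_def block_diag_def)

lemma transpose_block_mat:
  "transpose (block_mat A B C D) = block_mat (transpose A) (transpose C) (transpose B) (transpose D)"
  by (auto simp: vec_eq_iff transpose_def block_mat_def split: sum.splits)

section \<open>Cross-product matrices, inertial parameters and angular velocity\<close>

lemma skew_components:
  "skew x $ 1 $ 1 = 0" "skew x $ 1 $ 2 = - x $ 3" "skew x $ 1 $ 3 = x $ 2"
  "skew x $ 2 $ 1 = x $ 3" "skew x $ 2 $ 2 = 0" "skew x $ 2 $ 3 = - x $ 1"
  "skew x $ 3 $ 1 = - x $ 2" "skew x $ 3 $ 2 = x $ 1" "skew x $ 3 $ 3 = 0"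
  by (simp_all add: skew_def matrix_def cross_components axis_def)

lemma skew_mult: "skew x *v y = x \<times> y"
  by (simp add: vec_eq_iff forall_3 matrix_vector_mult_def sum_3 skew_components cross_components)

lemma inertial_params_components:
  "inertial_params r $ 1 = mass r" "inertial_params r $ 2 = first_moment r $ 1"
  "inertial_params r $ 3 = first_moment r $ 2" "inertial_params r $ 4 = first_moment r $ 3"
  "inertial_params r $ 5 = inertia r $ 1 $ 1" "inertial_params r $ 6 = inertia r $ 2 $ 2"
  "inertial_params r $ 7 = inertia r $ 3 $ 3" "inertial_params r $ 8 = inertia r $ 1 $ 2"
  "inertial_params r $ 9 = inertia r $ 2 $ 3" "inertial_params r $ 10 = inertia r $ 1 $ 3"
  by (simp_all add: inertial_params_def Let_def vector_def)

text \<open>The off-diagonal blocks are transposes of each other, and \<open>params_inertia\<close>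
  fills both triangles from the same three parameters, so symmetry holds for arbitrary parameter
  vectors.\<close>

lemma transpose_inertia_matrix: "transpose (inertia_matrix \<Phi>) = inertia_matrix \<Phi>"
proof -
  have "transpose (params_inertia \<Phi>) = params_inertia \<Phi>"
    by (simp add: vec_eq_iff transpose_def params_inertia_def forall_3)
  moreover have "transpose (- X) = - transpose X" for X :: "real^3^3"
    by (simp add: vec_eq_iff transpose_def)
  ultimately show ?thesis
    by (simp add: inertia_matrix_def transpose_block_mat transpose_scalar)
qed

text \<open>Left inverse of \<^const>\<open>skew\<close>; it replaces the definite description in
  \<^const>\<open>angular_velocity\<close> by a linear expression.\<close>

definition vee :: "real^3^3 \<Rightarrow> real^3"
  where "vee X = vector [X $ 3 $ 2, X $ 1 $ 3, X $ 2 $ 1]"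

lemma vee_skew: "vee (skew x) = x"
  by (simp add: vee_def skew_components vec_eq_iff forall_3)

lemma skew_vee: "transpose X = - X \<Longrightarrow> skew (vee X) = X"
proof -
  assume *: "transpose X = - X"
  have "X $ i $ j = - X $ j $ i" for i j
    using arg_cong[OF *, of "\<lambda>Y. Y $ j $ i"] by (simp add: transpose_def)
  from this[of 1 1] this[of 2 2] this[of 3 3] this[of 1 2] this[of 1 3] this[of 2 3]
  show ?thesis by (simp add: vec_eq_iff forall_3 skew_components vee_def)
qed

lemma bounded_linear_vee: "bounded_linear vee"
  unfolding linear_conv_bounded_linear[symmetric] linear_iff
  by (simp add: vee_def vec_eq_iff forall_3)

text \<open>Differentiating the constant \<open>transpose (Rot \<phi>) ** Rot \<phi>\<close> shows
  that the matrix in the description is skew-symmetric. Hence \<open>vee\<close> yields a solution,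
  and \<open>vee_skew\<close> makes it the only one.\<close>

lemma angular_velocity_eq:
  assumes orth: "\<And>\<phi>. orthogonal_matrix (Rot \<phi>)" and diff: "Rot differentiable (at \<phi>)"
  shows "angular_velocity Rot \<phi> v = vee (transpose (Rot \<phi>) ** frechet_derivative Rot (at \<phi>) v)"
proof -
  define D where "D = frechet_derivative Rot (at \<phi>)"
  have D: "(Rot has_derivative D) (at \<phi>)"
    using diff by (simp add: D_def frechet_derivative_works)
  have "((\<lambda>\<phi>. transpose (Rot \<phi>) ** Rot \<phi>) has_derivative
      (\<lambda>v. transpose (Rot \<phi>) ** D v + transpose (D v) ** Rot \<phi>)) (at \<phi>)"
    by (intro bounded_bilinear.FDERIV[OF bounded_bilinear_matrix_matrix_mult] D
        bounded_linear.has_derivative[OF bounded_linear_transpose])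
  moreover have "(\<lambda>\<phi>. transpose (Rot \<phi>) ** Rot \<phi>) = (\<lambda>_. mat 1)"
    using orth by (simp add: orthogonal_matrix)
  ultimately have "((\<lambda>\<phi>. mat 1) has_derivative
      (\<lambda>v. transpose (Rot \<phi>) ** D v + transpose (D v) ** Rot \<phi>)) (at \<phi>)"
    by simp
  then have "(\<lambda>v. transpose (Rot \<phi>) ** D v + transpose (D v) ** Rot \<phi>) = (\<lambda>_. 0)"
    by (rule has_derivative_unique[OF _ has_derivative_const])
  then have "transpose (D v) ** Rot \<phi> + transpose (Rot \<phi>) ** D v = 0"
    by (simp add: fun_eq_iff add.commute)
  then have "transpose (transpose (Rot \<phi>) ** D v) = - (transpose (Rot \<phi>) ** D v)"
    by (simp add: matrix_transpose_mul eq_neg_iff_add_eq_0)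
  then have "skew (vee (transpose (Rot \<phi>) ** D v)) = transpose (Rot \<phi>) ** D v"
    by (rule skew_vee)
  then show ?thesis
    unfolding angular_velocity_def D_def by (intro the_equality) (metis vee_skew)+
qed

lemma linear_angular_velocity:
  assumes "\<And>\<phi>. orthogonal_matrix (Rot \<phi>)" and "Rot differentiable (at \<phi>)"
  shows "linear (angular_velocity Rot \<phi>)"
proof -
  have "linear (\<lambda>X. vee (transpose (Rot \<phi>) ** X))"
    by (rule bounded_linear.linear, rule bounded_linear_compose[OF bounded_linear_vee],
        rule bounded_bilinear.bounded_linear_right[OF bounded_bilinear_matrix_matrix_mult])
  then have "linear (\<lambda>v. vee (transpose (Rot \<phi>) ** frechet_derivative Rot (at \<phi>) v))"
    using linear_compose[OF linear_frechet_derivative[OF assms(2)]] by (simp add: o_def)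
  moreover have "angular_velocity Rot \<phi> =
      (\<lambda>v. vee (transpose (Rot \<phi>) ** frechet_derivative Rot (at \<phi>) v))"
    by (rule ext, rule angular_velocity_eq[OF assms])
  ultimately show ?thesis by simp
qed

text \<open>Linearity of the angular velocity in the angle rates is what lets a matrix represent it:
  this is the relation defining the matrix E of angle rates.\<close>

lemma rate_matrix_mult:
  assumes "\<And>\<phi>. orthogonal_matrix (Rot \<phi>)" and "Rot differentiable (at \<phi>)"
  shows "rate_matrix Rot \<phi> *v v = angular_velocity Rot \<phi> v"
  unfolding rate_matrix_def
  by (rule fun_cong[OF matrix_vector_mul(2)[OF linear_angular_velocity[OF assms]]])

section \<open>Differentiability of the pose matrices and of the Jacobian\<close>

lemma differentiable_vec_nth:
  "f differentiable F \<Longrightarrow> (\<lambda>x. f x $ i) differentiable F"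
  unfolding differentiable_def
  by (elim exE, rule exI, rule bounded_linear.has_derivative[OF bounded_linear_vec_nth])

text \<open>The entries of the rate matrix contain first derivatives of \<open>Rot\<close>, hence
  the second-order assumption. It concerns derivatives in a fixed direction, which suffices because
  column \<open>j\<close> uses only the direction \<open>axis j 1\<close>.\<close>

lemma differentiable_rate_matrix:
  assumes orth: "\<And>\<phi>. orthogonal_matrix (Rot \<phi>)" and Rot: "twice_differentiable Rot"
  shows "rate_matrix Rot differentiable (at \<phi>)"
proof -
  have "(\<lambda>\<phi>. vee (transpose (Rot \<phi>) ** frechet_derivative Rot (at \<phi>) v)) differentiable (at \<phi>)" for v
  proof -
    obtain R' D' where "(Rot has_derivative R') (at \<phi>)"
      "((\<lambda>\<phi>. frechet_derivative Rot (at \<phi>) v) has_derivative D') (at \<phi>)"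
      using Rot unfolding twice_differentiable_def differentiable_def by blast
    then show ?thesis
      by (intro differentiableI) (rule bounded_linear.has_derivative[OF bounded_linear_vee]
          bounded_bilinear.FDERIV[OF bounded_bilinear_matrix_matrix_mult]
          bounded_linear.has_derivative[OF bounded_linear_transpose] | assumption)+
  qed
  then have "(\<lambda>\<phi>. \<chi> i j. angular_velocity Rot \<phi> (axis j 1) $ i) differentiable (at \<phi>)"
    using Rot unfolding twice_differentiable_def
    by (intro differentiable_vec_lambda differentiable_vec_nth) (simp add: angular_velocity_eq[OF orth])
  then show ?thesis
    by (simp add: rate_matrix_def[abs_def] matrix_def)
qed

lemma differentiable_pose_matrix:
  assumes "\<And>\<phi>. orthogonal_matrix (Rot \<phi>)" and Rot: "twice_differentiable Rot"
  shows "pose_matrix Rot differentiable (at \<phi>)"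
proof -
  have "(\<lambda>\<phi>. Rot \<phi> $ c $ a) differentiable (at \<phi>)" for c a
    using Rot unfolding twice_differentiable_def by (intro differentiable_vec_nth) simp
  moreover have "(\<lambda>\<phi>. rate_matrix Rot \<phi> $ c $ a) differentiable (at \<phi>)" for c a
    by (intro differentiable_vec_nth differentiable_rate_matrix assms)
  ultimately have "(\<lambda>\<phi>. pose_matrix Rot \<phi> $ i $ j) differentiable (at \<phi>)" for i j
    by (cases i; cases j) (simp_all add: pose_matrix_def block_mat_def transpose_def)
  then have "(\<lambda>\<phi>. \<chi> i j. pose_matrix Rot \<phi> $ i $ j) differentiable (at \<phi>)"
    by (intro differentiable_vec_lambda)
  then show ?thesis by simp
qed

lemma differentiable_pose_matrices:
  assumes "\<And>\<phi>. orthogonal_matrix (Rot \<phi>)" "twice_differentiable Rot"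
    and F: "F differentiable (at q)"
  shows "pose_matrices F Rot differentiable (at q)"
proof -
  have "(\<lambda>y. lower l (F y)) differentiable (at q)" for l
    unfolding lower_def by (intro differentiable_vec_lambda differentiable_vec_nth F)
  then have "(\<lambda>y. pose_matrix Rot (lower l (F y))) differentiable (at q)" for l
    by (rule differentiable_compose[OF differentiable_pose_matrix[OF assms(1,2)]])
  then have "(\<lambda>y. pose_matrix Rot (lower l (F y)) $ i $ j) differentiable (at q)" for l i j
    by (intro differentiable_vec_nth)
  then have "(\<lambda>y. pose_matrices F Rot y $ i $ j) differentiable (at q)" for i j
    \<comment> \<open>Entries linking different bodies are constantly zero.\<close>
    by (cases "fst i = fst j") (simp_all add: pose_matrices_def block_diag_def)
  then have "(\<lambda>y. \<chi> i j. pose_matrices F Rot y $ i $ j) differentiable (at q)"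
    by (intro differentiable_vec_lambda)
  then show ?thesis by simp
qed

lemma differentiable_jacobian:
  fixes F :: "real^'n \<Rightarrow> real^'m"
  assumes "twice_differentiable F"
  shows "(\<lambda>y. jacobian F (at y)) differentiable (at q)"
  unfolding jacobian_def matrix_def
  by (intro differentiable_vec_lambda differentiable_vec_nth)
    (use assms in \<open>simp add: twice_differentiable_def\<close>)

subsection \<open>Energies\<close>

text \<open>Only six entries of the inertia tensor are stored, so rebuilding it relies on its
  symmetry, which passes from the integrand to the integral because transposition is bounded
  linear.\<close>

lemma params_inertia_inertial_params:
  assumes "integrable lborel (\<lambda>x. r x *\<^sub>R (transpose (skew x) ** skew x))"
  shows "params_inertia (inertial_params r) = inertia r"
proof -
  have "transpose (inertia r) = inertia r"
    unfolding inertia_def integral_bounded_linear[OF bounded_linear_transpose assms, symmetric]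
    by (simp add: transpose_scalar matrix_transpose_mul)
  then have "transpose (inertia r) $ j $ i = inertia r $ j $ i" for i j
    by simp
  then have "inertia r $ i $ j = inertia r $ j $ i" for i j
    by (simp add: transpose_def)
  then show ?thesis
    by (simp add: params_inertia_def inertial_params_components vec_eq_iff forall_3)
qed

text \<open>The weights \<open>1 - s\<close> and \<open>s\<close> add up to 1 on the rigid-motion
  part, leaving the moments of \<open>r\<close>. The cross term with the particle velocity pairs the
  flux with \<open>a\<close> and \<open>\<omega>\<close>, and the remaining square involves the
  particles alone.\<close>

lemma integral_kinetic_density:
  fixes Rot \<phi> v \<phi>' r s p
  defines "a \<equiv> transpose (Rot \<phi>) *v v" and "\<omega> \<equiv> angular_velocity Rot \<phi> \<phi>'"
    and "P \<equiv> LINT x|lborel. particle_flux (s x) (r x) (p x) x"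
  assumes r: "integrable lborel r" "integrable lborel (\<lambda>x. r x *\<^sub>R x)"
      "integrable lborel (\<lambda>x. r x *\<^sub>R (transpose (skew x) ** skew x))"
    and flux: "integrable lborel (\<lambda>x. particle_flux (s x) (r x) (p x) x)"
    and p: "integrable lborel (\<lambda>x. s x * r x * (norm (p x))\<^sup>2)"
  shows "(LINT x|lborel. kinetic_density Rot (s x) (r x) (p x) \<phi> v \<phi>' x) =
    a \<bullet> (mass r *\<^sub>R a - first_moment r \<times> \<omega>) + \<omega> \<bullet> (first_moment r \<times> a + inertia r *v \<omega>)
    + 2 * (a \<bullet> (\<chi> i. P $ Inl i) + \<omega> \<bullet> (\<chi> i. P $ Inr i))
    + (LINT x|lborel. s x * r x * (norm (p x))\<^sup>2)"
proof -
  have pointwise: "kinetic_density Rot (s x) (r x) (p x) \<phi> v \<phi>' x =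
      r x * (a \<bullet> a) + 2 * ((\<omega> \<times> (r x *\<^sub>R x)) \<bullet> a)
      + ((r x *\<^sub>R (transpose (skew x) ** skew x)) *v \<omega>) \<bullet> \<omega>
      + 2 * (a \<bullet> (\<chi> i. particle_flux (s x) (r x) (p x) x $ Inl i)
           + \<omega> \<bullet> (\<chi> i. particle_flux (s x) (r x) (p x) x $ Inr i))
      + s x * r x * (norm (p x))\<^sup>2" for x
  proof -
    have flux_blocks: "(\<chi> i. particle_flux (s x) (r x) (p x) x $ Inl i) = (s x * r x) *\<^sub>R p x"
      "(\<chi> i. particle_flux (s x) (r x) (p x) x $ Inr i) = (s x * r x) *\<^sub>R (x \<times> p x)"
      by (simp_all add: particle_flux_def block_col_def vec_eq_iff matrix_vector_mult_def
          skew_mult[symmetric] mat_def if_distrib[of "\<lambda>x. x * _"] cong: if_cong)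
    have "((transpose (skew x) ** skew x) *v \<omega>) \<bullet> \<omega> = (x \<times> \<omega>) \<bullet> (x \<times> \<omega>)"
      by (simp add: matrix_vector_mul_assoc[symmetric] skew_mult dot_lmul_matrix)
    then show ?thesis
      unfolding flux_blocks kinetic_density_def a_def[symmetric] \<omega>_def[symmetric]
      by (simp add: scaleR_matrix_vector_assoc[symmetric] power2_norm_eq_inner)
         (simp add: inner_vec_def sum_3 cross_components algebra_simps)
  qed
  \<comment> \<open>Apart from the mass term and the pure particle term, the integrand is a
    combination of linear functionals of the second-moment, first-moment and flux integrands; being
    bounded, \<open>Q\<close>, \<open>K\<close> and \<open>E\<close> commute with the
    integral.\<close>
  define Q where "Q X = ((X *v \<omega>) \<bullet> \<omega>)" for X :: "real^3^3"
  define K where "K y = (\<omega> \<times> y) \<bullet> a" for y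
  define E where "E f = a \<bullet> (\<chi> i. f $ Inl i) + \<omega> \<bullet> (\<chi> i. f $ Inr i)" for f :: "real^(3 + 3)"
  have lin: "bounded_linear Q" "bounded_linear K" "bounded_linear E"
    unfolding linear_conv_bounded_linear[symmetric] linear_iff Q_def K_def E_def
    by (simp_all add: matrix_vector_mult_add_rdistrib scaleR_matrix_vector_assoc[symmetric]
        inner_add_left cross_add_right cross_mult_right)
      (simp_all add: inner_vec_def sum.distrib sum_distrib_left algebra_simps)
  note ints = integrable_bounded_linear[OF lin(1) r(3)] integrable_bounded_linear[OF lin(2) r(2)]
    integrable_bounded_linear[OF lin(3) flux]
  have "(LINT x|lborel. kinetic_density Rot (s x) (r x) (p x) \<phi> v \<phi>' x) =
      (LINT x|lborel. r x * (a \<bullet> a) + 2 * K (r x *\<^sub>R x) + Q (r x *\<^sub>R (transpose (skew x) ** skew x))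
      + 2 * E (particle_flux (s x) (r x) (p x) x) + s x * r x * (norm (p x))\<^sup>2)"
    unfolding pointwise K_def Q_def E_def ..
  also have "\<dots> = mass r * (a \<bullet> a) + 2 * K (first_moment r) + Q (inertia r) + 2 * E P
      + (LINT x|lborel. s x * r x * (norm (p x))\<^sup>2)"
    using ints r(1) p
      integral_bounded_linear[OF lin(1) r(3)] integral_bounded_linear[OF lin(2) r(2)]
      integral_bounded_linear[OF lin(3) flux]
    by (simp add: mass_def first_moment_def inertia_def P_def)
  \<comment> \<open>By invariance of the triple product, \<open>2 * K (first_moment r)\<close>
    splits evenly into the two coupling terms, one for each off-diagonal block of the inertia
    matrix.\<close>
  finally show ?thesis
    unfolding K_def Q_def E_def
    by (simp add: inner_add_right inner_commute[of \<omega> "inertia r *v \<omega>"])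
      (simp add: inner_vec_def sum_3 cross_components algebra_simps)
qed

text \<open>Body by body this is \<open>integral_kinetic_density\<close>, with \<open>a\<close> and
  \<open>\<omega>\<close> the two halves of the block of \<open>X u\<close> for that body. The last
  sum depends on neither \<open>y\<close> nor \<open>u\<close> and will serve as
  \<open>\<kappa>\<close>.\<close>

lemma sum_kinetic_energy:
  fixes F :: "real^'n \<Rightarrow> real^('b::finite \<times> (3 + 3))" and Rot y
  assumes orth: "\<And>\<phi>. orthogonal_matrix (Rot \<phi>)" and Rot: "\<And>\<phi>. Rot differentiable (at \<phi>)"
    and r: "\<And>l. integrable lborel (\<lambda>x. \<rho> l x t)" "\<And>l. integrable lborel (\<lambda>x. \<rho> l x t *\<^sub>R x)"
      "\<And>l. integrable lborel (\<lambda>x. \<rho> l x t *\<^sub>R (transpose (skew x) ** skew x))"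
    and flux: "\<And>l. integrable lborel (\<lambda>x. particle_flux (\<sigma> l x t) (\<rho> l x t) (\<nu> l x t) x)"
    and kin: "\<And>l. integrable lborel (\<lambda>x. body_kinetic_density F Rot \<sigma> \<rho> \<nu> l y 0 t x)"
  defines "X \<equiv> \<lambda>u. (pose_matrices F Rot y ** jacobian F (at y)) *v u"
  shows "(\<Sum>l\<in>UNIV. kinetic_energy F Rot \<sigma> \<rho> \<nu> l y u t) =
    1/2 * (X u \<bullet> (inertia_matrices (Theta \<rho> t) *v X u)) + X u \<bullet> Psi \<sigma> \<rho> \<nu> t
    + 1/2 * (\<Sum>l\<in>UNIV. LINT x|lborel. \<sigma> l x t * \<rho> l x t * (norm (\<nu> l x t))\<^sup>2)"
proof -
  \<comment> \<open>at zero generalized velocity the kinetic density is that of the particles alone\<close>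
  have particle: "integrable lborel (\<lambda>x. \<sigma> l x t * \<rho> l x t * (norm (\<nu> l x t))\<^sup>2)" for l
  proof -
    have "upper l 0 = 0" "lower l 0 = 0" for l :: 'b
      by (simp_all add: upper_def lower_def vec_eq_iff)
    then have "body_kinetic_density F Rot \<sigma> \<rho> \<nu> l y 0 t x = \<sigma> l x t * \<rho> l x t * (norm (\<nu> l x t))\<^sup>2" for x
      using linear_0[OF linear_angular_velocity[OF orth Rot]]
      by (simp add: body_kinetic_density_def kinetic_density_def)
    with kin[of l] show ?thesis by simp
  qed
  have "2 * kinetic_energy F Rot \<sigma> \<rho> \<nu> l y u t =
      upper l (X u) \<bullet> upper l (inertia_matrices (Theta \<rho> t) *v X u)
      + lower l (X u) \<bullet> lower l (inertia_matrices (Theta \<rho> t) *v X u)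
      + 2 * (upper l (X u) \<bullet> upper l (Psi \<sigma> \<rho> \<nu> t) + lower l (X u) \<bullet> lower l (Psi \<sigma> \<rho> \<nu> t))
      + (LINT x|lborel. \<sigma> l x t * \<rho> l x t * (norm (\<nu> l x t))\<^sup>2)" for l
  proof -
    define r where "r = (\<lambda>x. \<rho> l x t)"
    have X: "upper l (X u) = transpose (Rot (lower l (F y))) *v upper l (jacobian F (at y) *v u)"
      "lower l (X u) = angular_velocity Rot (lower l (F y)) (lower l (jacobian F (at y) *v u))"
      by (simp_all add: X_def matrix_vector_mul_assoc[symmetric] pose_matrices_def pose_matrix_def
          block_diag_mult_blocks rate_matrix_mult[OF orth Rot] del: transpose_matrix_vector)
    have Psi: "upper l (Psi \<sigma> \<rho> \<nu> t) =
        (\<chi> i. (LINT x|lborel. particle_flux (\<sigma> l x t) (\<rho> l x t) (\<nu> l x t) x) $ Inl i)"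
      "lower l (Psi \<sigma> \<rho> \<nu> t) =
        (\<chi> i. (LINT x|lborel. particle_flux (\<sigma> l x t) (\<rho> l x t) (\<nu> l x t) x) $ Inr i)"
      by (simp_all add: upper_def lower_def Psi_def)
    have params: "params_mass (Theta \<rho> t $ l) = mass r" "params_moment (Theta \<rho> t $ l) = first_moment r"
      "params_inertia (Theta \<rho> t $ l) = inertia r"
      using params_inertia_inertial_params[OF assms(5)[of l]]
      by (simp_all add: Theta_def params_mass_def params_moment_def inertial_params_components
          vec_eq_iff forall_3 r_def)
    \<comment> \<open>Turns the lower left block of the inertia matrix into a plain cross product
      with \<open>h\<close>.\<close>
    have "- transpose (skew h) = skew h" for h
      by (simp add: vec_eq_iff forall_3 transpose_def skew_components)
    moreover have "(- skew h) *v \<omega> = - (h \<times> \<omega>)" for h \<omega>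
      by (simp add: vec_eq_iff forall_3 matrix_vector_mult_def sum_3 skew_components cross_components)
    ultimately have Z: "upper l (inertia_matrices (Theta \<rho> t) *v x)
        = mass r *\<^sub>R upper l x - first_moment r \<times> lower l x"
      "lower l (inertia_matrices (Theta \<rho> t) *v x)
        = first_moment r \<times> upper l x + inertia r *v lower l x" for x
      by (simp_all add: inertia_matrices_def inertia_matrix_def block_diag_mult_blocks params
          scaleR_matrix_vector_assoc[symmetric] skew_mult)
    show ?thesis
      unfolding Z unfolding X Psi kinetic_energy_def body_kinetic_density_def Let_def
      by (simp add: integral_kinetic_density r flux particle r_def del: transpose_matrix_vector)
  qed
  then have "2 * (\<Sum>l\<in>UNIV. kinetic_energy F Rot \<sigma> \<rho> \<nu> l y u t) =
      X u \<bullet> (inertia_matrices (Theta \<rho> t) *v X u) + 2 * (X u \<bullet> Psi \<sigma> \<rho> \<nu> t)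
      + (\<Sum>l\<in>UNIV. LINT x|lborel. \<sigma> l x t * \<rho> l x t * (norm (\<nu> l x t))\<^sup>2)"
    by (simp add: inner_blocks sum.distrib sum_distrib_left)
  then show ?thesis by simp
qed

text \<open>Every entry is linear in the inertial parameters. The time derivative of the inertia
  matrices is therefore the same expression at the parameter rates, which is the origin of M
  evaluated at the derivative of Theta.\<close>

lemma bounded_linear_inertia_matrices: "bounded_linear inertia_matrices"
proof -
  have "inertia_matrix (\<Phi> + \<Phi>') = inertia_matrix \<Phi> + inertia_matrix \<Phi>'"
    "inertia_matrix (c *\<^sub>R \<Phi>) = c *\<^sub>R inertia_matrix \<Phi>" for \<Phi> \<Phi>' c
    by (auto simp: vec_eq_iff forall_3 inertia_matrix_def block_mat_def params_mass_def
        params_moment_def params_inertia_def transpose_def skew_components mat_def algebra_simps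
        split: sum.split)
  then show ?thesis
    unfolding linear_conv_bounded_linear[symmetric] linear_iff
    by (simp add: inertia_matrices_def block_diag_def vec_eq_iff)
qed

lemma differentiable_total_potential:
  assumes F: "F differentiable (at q)" and Rot: "\<And>\<phi>. Rot differentiable (at \<phi>)"
  shows "(\<lambda>y. total_potential F Rot g y \<Theta>) differentiable (at q)"
proof -
  have "(\<lambda>y. potential_energy F Rot g l y \<Theta>) differentiable (at q)" for l
  proof -
    have "(\<lambda>y. upper l (F y)) differentiable (at q)"
      unfolding upper_def by (intro differentiable_vec_lambda differentiable_vec_nth F)
    then obtain u where u: "((\<lambda>y. upper l (F y)) has_derivative u) (at q)"
      by (auto simp: differentiable_def)
    have "(\<lambda>y. lower l (F y)) differentiable (at q)"
      unfolding lower_def by (intro differentiable_vec_lambda differentiable_vec_nth F)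
    then have "(\<lambda>y. Rot (lower l (F y))) differentiable (at q)"
      by (rule differentiable_compose[OF Rot])
    then obtain R where R: "((\<lambda>y. Rot (lower l (F y))) has_derivative R) (at q)"
      by (auto simp: differentiable_def)
    show ?thesis
      unfolding potential_energy_def
      by (rule differentiableI) (rule has_derivative_inner_right has_derivative_add
          has_derivative_scaleR_right u R
          bounded_linear.has_derivative[OF bounded_bilinear.bounded_linear_left[OF
            bounded_bilinear_matrix_vector_mult]])+
  qed
  then show ?thesis
    unfolding total_potential_def by (intro differentiable_sum) auto
qed

subsection \<open>Christoffel and gyroscopic terms\<close>

lemma linear_axis_expansion:
  assumes "linear (f :: real^'n \<Rightarrow> real)"
  shows "f u = (\<Sum>i\<in>UNIV. f (axis i 1) * u $ i)"
proof -
  have "f u = f (\<Sum>i\<in>UNIV. u $ i *\<^sub>R axis i 1)"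
    by (simp add: basis_expansion[of u, unfolded scalar_mult_eq_scaleR])
  then show ?thesis
    by (simp add: linear_sum[OF assms] linear_scale[OF assms] mult.commute)
qed

text \<open>The nesting of the sums follows \<open>C_mat\<close> applied to a vector: the outer
  index comes from the matrix-vector product, the inner one from the sum of Christoffel
  symbols.\<close>

lemma bilinear_axis_expansion:
  assumes "\<And>b. linear (\<lambda>a. B a b :: real)" and "\<And>a. linear (B a)"
  shows "B u (v :: real^'n) = (\<Sum>j\<in>UNIV. \<Sum>i\<in>UNIV. B (axis i 1) (axis j 1) * (u :: real^'n) $ i * v $ j)"
  using linear_axis_expansion[OF assms(1), of u] linear_axis_expansion[OF assms(2), of _ v]
  by (simp add: sum_distrib_left sum_distrib_right mult_ac)

lemma matrix_entry_eq_inner: "(A :: real^'n^'m) $ k $ j = axis k 1 \<bullet> (A *v axis j 1)"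
  by (simp add: inner_axis' matrix_vector_mult_basis column_def)

text \<open>An entry of the congruence is the \<open>Z\<close>-pairing of two columns of
  \<open>A y\<close>; with \<open>Z\<close> constant, only the two factors \<open>A y\<close> are
  differentiated.\<close>

lemma partial_congruence:
  fixes A :: "real^'n \<Rightarrow> real^'k^'m"
  assumes A: "(A has_derivative A') (at q)"
  shows "partial i (\<lambda>y. (transpose (A y) ** Z ** A y) $ k $ j) q =
    (A' (axis i 1) *v axis k 1) \<bullet> (Z *v (A q *v axis j 1))
    + (A q *v axis k 1) \<bullet> (Z *v (A' (axis i 1) *v axis j 1))"
proof -
  have entry: "(transpose (A y) ** Z ** A y) $ k $ j = (A y *v axis k 1) \<bullet> (Z *v (A y *v axis j 1))" for y
    unfolding matrix_entry_eq_inner matrix_vector_mul_assoc[symmetric]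
      inner_matrix_vector_right[of _ "transpose (A y)"] transpose_transpose ..
  have "((\<lambda>y. (transpose (A y) ** Z ** A y) $ k $ j) has_derivative
     (\<lambda>h. (A q *v axis k 1) \<bullet> (Z *v (A' h *v axis j 1))
       + (A' h *v axis k 1) \<bullet> (Z *v (A q *v axis j 1)))) (at q)"
    unfolding entry
    by (rule has_derivative_inner
        bounded_linear.has_derivative[OF bounded_bilinear.bounded_linear_right[OF bounded_bilinear_matrix_vector_mult]]
        bounded_linear.has_derivative[OF bounded_bilinear.bounded_linear_left[OF bounded_bilinear_matrix_vector_mult]]
        A)+
  from partial_eq[OF this] show ?thesis by simp
qed

text \<open>Contracting the Christoffel symbols twice with \<open>u\<close> makes their first two
  terms equal. What remains is the derivative of the form along \<open>u\<close>, minus half its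
  derivative along \<open>axis k 1\<close>.\<close>

lemma C_mat_mult_component:
  fixes F :: "real^'n \<Rightarrow> real^('b::finite \<times> (3 + 3))" and Rot \<Theta>
  defines "A \<equiv> \<lambda>y. pose_matrices F Rot y ** jacobian F (at y)"
    and "Z \<equiv> inertia_matrices \<Theta>"
  assumes A: "(A has_derivative A') (at q)"
  shows "(C_mat F Rot q u \<Theta> *v u) $ k =
    ((Z *v (A q *v u)) v* A' u + (Z *v (A' u *v u)) v* A q) $ k
    - (A' (axis k 1) *v u) \<bullet> (Z *v (A q *v u))"
proof -
  \<comment> \<open>\<open>T h a b\<close> is the derivative in direction \<open>h\<close> of the
    bilinear form that \<open>M_mat\<close> defines, evaluated at \<open>a\<close> and
    \<open>b\<close>.\<close>
  define T where "T h a b = (A' h *v a) \<bullet> (Z *v (A q *v b)) + (A q *v a) \<bullet> (Z *v (A' h *v b))" for h a b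
  have M: "M_mat F Rot y \<Theta> = transpose (A y) ** Z ** A y" for y
    by (simp add: M_mat_def A_def Z_def matrix_transpose_mul matrix_mul_assoc)
  have partial_M: "partial i (\<lambda>y. M_mat F Rot y \<Theta> $ k $ j) q = T (axis i 1) (axis k 1) (axis j 1)" for i k j
    unfolding M partial_congruence[OF A] T_def ..
  have A'_linear: "A' (x + y) = A' x + A' y" "A' (c *\<^sub>R x) = c *\<^sub>R A' x" for x y c
    using has_derivative_linear[OF A] by (simp_all add: linear_iff)
  have lin: "linear (\<lambda>h. T h a b)" "linear (\<lambda>a. T h a b)" "linear (\<lambda>b. T h a b)" for h a b
    unfolding linear_iff T_def A'_linear
    by (simp_all add: algebra_simps inner_add_left inner_add_right matrix_vector_mult_scaleR
        scaleR_matrix_vector_assoc[symmetric])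
  have "(C_mat F Rot q u \<Theta> *v u) $ k =
    (\<Sum>j\<in>UNIV. \<Sum>i\<in>UNIV. 1/2 * (T (axis i 1) (axis k 1) (axis j 1)
      + T (axis j 1) (axis k 1) (axis i 1) - T (axis k 1) (axis i 1) (axis j 1)) * u $ i * u $ j)"
    by (simp add: C_mat_def matrix_vector_mult_def christoffel_def partial_M sum_distrib_right)
  also have "\<dots> = 1/2 * ((\<Sum>j\<in>UNIV. \<Sum>i\<in>UNIV. T (axis i 1) (axis k 1) (axis j 1) * u $ i * u $ j)
      + (\<Sum>j\<in>UNIV. \<Sum>i\<in>UNIV. T (axis j 1) (axis k 1) (axis i 1) * u $ j * u $ i)
      - (\<Sum>j\<in>UNIV. \<Sum>i\<in>UNIV. T (axis k 1) (axis i 1) (axis j 1) * u $ i * u $ j))"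
    unfolding sum_distrib_left sum.distrib[symmetric] sum_subtractf[symmetric]
    by (intro sum.cong refl) (simp add: algebra_simps)
  also have "(\<Sum>j\<in>UNIV. \<Sum>i\<in>UNIV. T (axis j 1) (axis k 1) (axis i 1) * u $ j * u $ i)
      = (\<Sum>j\<in>UNIV. \<Sum>i\<in>UNIV. T (axis i 1) (axis k 1) (axis j 1) * u $ i * u $ j)"
    by (rule sum.swap)
  also have "\<dots> = T u (axis k 1) u"
    by (rule bilinear_axis_expansion[symmetric]) (rule lin)+
  also have "(\<Sum>j\<in>UNIV. \<Sum>i\<in>UNIV. T (axis k 1) (axis i 1) (axis j 1) * u $ i * u $ j) = T (axis k 1) u u"
    by (rule bilinear_axis_expansion[symmetric]) (rule lin)+
  \<comment> \<open>Symmetry of \<open>Z\<close> makes both summands of \<open>T\<close> equal, and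
    the 2 cancels the 1/2 of the Christoffel symbols.\<close>
  also have "T (axis k 1) u u = 2 * ((A' (axis k 1) *v u) \<bullet> (Z *v (A q *v u)))"
  proof -
    have "transpose Z = Z"
      by (simp add: Z_def inertia_matrices_def transpose_block_diag transpose_inertia_matrix)
    then show ?thesis
      using inner_matrix_vector_right[of "A q *v u" Z "A' (axis k 1) *v u"]
      by (simp add: T_def inner_commute del: transpose_matrix_vector)
  qed
  finally show ?thesis
    by (simp add: T_def vector_matrix_mult_component del: matrix_vector_mult_basis)
qed

text \<open>The first term is the contribution of \<open>\<Psi>\<close> when \<open>A\<close> is
  differentiated along the motion in the momentum, the second its contribution to the partial
  derivative by \<open>q\<close>. Their difference is antisymmetric as a matrix.\<close>

lemma H_mat_mult_component:
  fixes F :: "real^'n \<Rightarrow> real^('b::finite \<times> (3 + 3))" and Rot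
  defines "A \<equiv> \<lambda>y. pose_matrices F Rot y ** jacobian F (at y)"
  assumes A: "(A has_derivative A') (at q)"
  shows "(H_mat F Rot q \<Psi> *v u) $ k = (\<Psi> v* A' u) $ k - (A' (axis k 1) *v u) \<bullet> \<Psi>"
proof -
  define p where "p = (\<lambda>y. transpose (jacobian F (at y)) *v (transpose (pose_matrices F Rot y) *v \<Psi>))"
  have p: "p = (\<lambda>y. \<Psi> v* A y)"
    by (simp add: p_def A_def vector_matrix_mul_assoc fun_eq_iff)
  have "(p has_derivative (\<lambda>h. \<Psi> v* A' h)) (at q)"
    unfolding p by (rule bounded_linear.has_derivative[OF bounded_bilinear.bounded_linear_right[OF
          bounded_bilinear_vector_matrix_mult] A])
  then have J: "jacobian p (at q) *v h = \<Psi> v* A' h" for h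
    by (metis frechet_derivative_at jacobian_def matrix_vector_mul(2) has_derivative_linear)
  have "(transpose (jacobian p (at q)) *v u) $ k = (A' (axis k 1) *v u) \<bullet> \<Psi>"
    unfolding transpose_matrix_vector vector_matrix_mult_component J dot_lmul_matrix
    by (rule inner_commute)
  moreover have "H_mat F Rot q \<Psi> = jacobian p (at q) - transpose (jacobian p (at q))"
    by (simp add: H_mat_def p_def Let_def)
  ultimately show ?thesis
    by (simp add: matrix_vector_mult_diff_rdistrib J del: transpose_matrix_vector)
qed

section \<open>Assembly of the generalized robotics equation\<close>

theorem mainTheorem7:
  fixes F :: "real^'n \<Rightarrow> real^('b::finite \<times> (3 + 3))"
    and Rot :: "real^3 \<Rightarrow> real^3^3"
    and \<rho> \<sigma> :: "'b \<Rightarrow> real^3 \<Rightarrow> real \<Rightarrow> real"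
    and \<nu> :: "'b \<Rightarrow> real^3 \<Rightarrow> real \<Rightarrow> real^3"
    and g :: "real^3"
    and q q' q'' \<tau> w :: "real \<Rightarrow> real^'n"
    and \<Theta>' :: "real \<Rightarrow> real^10^'b"
    and \<Psi>' :: "real \<Rightarrow> real^('b \<times> (3 + 3))"
    and T :: "real set"
  assumes T: "open T"
    and F_smooth: "twice_differentiable F"
    and Rot_smooth: "twice_differentiable Rot"
    and Rot_SO3: "\<And>\<phi>. rotation_matrix (Rot \<phi>)"
    and portion: "\<And>l x t. t \<in> T \<Longrightarrow> 0 \<le> \<sigma> l x t \<and> \<sigma> l x t \<le> 1"
    and int_mass: "\<And>l t. t \<in> T \<Longrightarrow> integrable lborel (\<lambda>x. \<rho> l x t)"
    and int_moment: "\<And>l t. t \<in> T \<Longrightarrow> integrable lborel (\<lambda>x. \<rho> l x t *\<^sub>R x)"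
    and int_inertia: "\<And>l t. t \<in> T \<Longrightarrow>
          integrable lborel (\<lambda>x. \<rho> l x t *\<^sub>R (transpose (skew x) ** skew x))"
    and int_flux: "\<And>l t. t \<in> T \<Longrightarrow>
          integrable lborel (\<lambda>x. particle_flux (\<sigma> l x t) (\<rho> l x t) (\<nu> l x t) x)"
    and int_kinetic: "\<And>l y u t. t \<in> T \<Longrightarrow>
          integrable lborel (\<lambda>x. body_kinetic_density F Rot \<sigma> \<rho> \<nu> l y u t x)"
    and q': "\<And>t. t \<in> T \<Longrightarrow> (q has_vector_derivative q' t) (at t)"
    and q'': "\<And>t. t \<in> T \<Longrightarrow> (q' has_vector_derivative q'' t) (at t)"
    and \<Theta>': "\<And>t. t \<in> T \<Longrightarrow> (Theta \<rho> has_vector_derivative \<Theta>' t) (at t)"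
    and \<Psi>': "\<And>t. t \<in> T \<Longrightarrow> (Psi \<sigma> \<rho> \<nu> has_vector_derivative \<Psi>' t) (at t)"
  shows "\<forall>t\<in>T.
    (\<forall>k. lagrange_equation (lagrangian F Rot \<sigma> \<rho> \<nu> g) q q' t k (\<tau> t $ k + w t $ k))
    \<longleftrightarrow>
    M_mat F Rot (q t) (Theta \<rho> t) *v q'' t
      + (C_mat F Rot (q t) (q' t) (Theta \<rho> t) + M_mat F Rot (q t) (\<Theta>' t)
          + H_mat F Rot (q t) (Psi \<sigma> \<rho> \<nu> t)) *v q' t
      + G_vec F Rot g (q t) (Theta \<rho> t)
    = \<tau> t + w t
      - transpose (jacobian F (at (q t))) *v (transpose (pose_matrices F Rot (q t)) *v \<Psi>' t)"
proof
  fix t assume t: "t \<in> T"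
  define A where "A = (\<lambda>y. pose_matrices F Rot y ** jacobian F (at y))"
  define Z where "Z = (\<lambda>s. inertia_matrices (Theta \<rho> s))"
  define \<kappa> where "\<kappa> = (\<lambda>s. 1/2 * (\<Sum>l\<in>UNIV. LINT x|lborel. \<sigma> l x s * \<rho> l x s * (norm (\<nu> l x s))\<^sup>2))"
  have orth: "orthogonal_matrix (Rot \<phi>)" for \<phi>
    using Rot_SO3 by (simp add: rotation_matrix_def)
  have F: "F differentiable (at y)" and Rot: "Rot differentiable (at \<phi>)" for y \<phi>
    using F_smooth Rot_smooth by (simp_all add: twice_differentiable_def)
  obtain P' J' where "(pose_matrices F Rot has_derivative P') (at (q t))"
    "((\<lambda>y. jacobian F (at y)) has_derivative J') (at (q t))"
    using differentiable_pose_matrices[OF orth Rot_smooth F] differentiable_jacobian[OF F_smooth]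
    unfolding differentiable_def by blast
  \<comment> \<open>Existence of \<open>A'\<close> is enough: the Lagrange equation and the matrices
    C and H are all expressed through this same derivative.\<close>
  from bounded_bilinear.FDERIV[OF bounded_bilinear_matrix_matrix_mult this]
  obtain A' where A: "(A has_derivative A') (at (q t))"
    unfolding A_def by blast
  obtain U' where U: "((\<lambda>y. total_potential F Rot g y (Theta \<rho> t)) has_derivative U') (at (q t))"
    using differentiable_total_potential[OF F Rot] unfolding differentiable_def by blast
  have L: "lagrangian F Rot \<sigma> \<rho> \<nu> g y u s =
      1/2 * ((A y *v u) \<bullet> (Z s *v (A y *v u))) + (A y *v u) \<bullet> Psi \<sigma> \<rho> \<nu> s + \<kappa> s
        - total_potential F Rot g y (Theta \<rho> s)" if "s \<in> T" for y u s
    unfolding lagrangian_def A_def Z_def \<kappa>_def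
    by (subst sum_kinetic_energy[OF orth Rot]) (simp_all add: int_mass int_moment int_inertia int_flux int_kinetic that)
  have Z_sym: "transpose (Z s) = Z s" for s
    by (simp add: Z_def inertia_matrices_def transpose_block_diag transpose_inertia_matrix)
  have Z_deriv: "(Z has_vector_derivative inertia_matrices (\<Theta>' t)) (at t)"
    unfolding Z_def by (rule bounded_linear.has_vector_derivative[OF bounded_linear_inertia_matrices \<Theta>'[OF t]])
  have M: "M_mat F Rot y \<Theta> *v x = (inertia_matrices \<Theta> *v (A y *v x)) v* A y" for y \<Theta> x
    by (simp add: M_mat_def A_def matrix_vector_mul_assoc[symmetric] vector_matrix_mul_assoc)
  have A_apply: "pose_matrices F Rot y ** jacobian F (at y) = A y" for y
    by (simp add: A_def)
  have JQ: "transpose (jacobian F (at y)) *v (transpose (pose_matrices F Rot y) *v x) = x v* A y" for y x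
    by (simp add: A_def vector_matrix_mul_assoc)
  have lagrange: "lagrange_equation (lagrangian F Rot \<sigma> \<rho> \<nu> g) q q' t k f \<longleftrightarrow>
    ((Z t *v (A (q t) *v q' t) + Psi \<sigma> \<rho> \<nu> t) v* A' (q' t)
      + (inertia_matrices (\<Theta>' t) *v (A (q t) *v q' t) + Z t *v (A' (q' t) *v q' t)
          + Z t *v (A (q t) *v q'' t) + \<Psi>' t) v* A (q t)) $ k
      - (A' (axis k 1) *v q' t) \<bullet> (Z t *v (A (q t) *v q' t) + Psi \<sigma> \<rho> \<nu> t)
      + U' (axis k 1) = f" for k f
    by (rule lagrange_equation_quadratic[where \<kappa> = \<kappa>
          and U = "\<lambda>s y. total_potential F Rot g y (Theta \<rho> s)"])
      (rule T t L Z_sym A U q'[OF t] q''[OF t] Z_deriv \<Psi>'[OF t] | assumption)+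
  \<comment> \<open>Both sides become the same scalar equation: terms with \<open>A'\<close> give C
    and H, the derivative of \<open>Z\<close> and the acceleration give the two M terms,
    \<open>U'\<close> gives G, and the term with \<open>\<Psi>' t\<close> moves to the
    right.\<close>
  have "lagrange_equation (lagrangian F Rot \<sigma> \<rho> \<nu> g) q q' t k (\<tau> t $ k + w t $ k) \<longleftrightarrow>
    (M_mat F Rot (q t) (Theta \<rho> t) *v q'' t
      + (C_mat F Rot (q t) (q' t) (Theta \<rho> t) + M_mat F Rot (q t) (\<Theta>' t)
          + H_mat F Rot (q t) (Psi \<sigma> \<rho> \<nu> t)) *v q' t
      + G_vec F Rot g (q t) (Theta \<rho> t)) $ k
    = (\<tau> t + w t
      - transpose (jacobian F (at (q t))) *v (transpose (pose_matrices F Rot (q t)) *v \<Psi>' t)) $ k" for k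
    unfolding lagrange
      JQ matrix_vector_mult_add_rdistrib M vector_add_component vector_minus_component
      C_mat_mult_component[OF A[unfolded A_def], folded A_def]
      H_mat_mult_component[OF A[unfolded A_def], folded A_def]
    by (simp add: G_vec_def partial_eq[OF U] A_apply Z_def vector_matrix_left_distrib inner_add_right)
      (simp add: algebra_simps)
  then show "(\<forall>k. lagrange_equation (lagrangian F Rot \<sigma> \<rho> \<nu> g) q q' t k (\<tau> t $ k + w t $ k))
    \<longleftrightarrow>
    M_mat F Rot (q t) (Theta \<rho> t) *v q'' t
      + (C_mat F Rot (q t) (q' t) (Theta \<rho> t) + M_mat F Rot (q t) (\<Theta>' t)
          + H_mat F Rot (q t) (Psi \<sigma> \<rho> \<nu> t)) *v q' t
      + G_vec F Rot g (q t) (Theta \<rho> t)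
    = \<tau> t + w t
      - transpose (jacobian F (at (q t))) *v (transpose (pose_matrices F Rot (q t)) *v \<Psi>' t)"
    unfolding vec_eq_iff by blast
qed

end
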